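(* Let $n\ge 1$ and let $\mathbf{a}=(a_1,\dots,a_n)\in\mathbb{C}^n$ with all $a_j\neq 0$ and $A=a_1+\cdots+a_n\neq 0$. Then the sequence $(p_k)_{k\ge 0}$ defined by $$p_k=(-1)^k A^{-k} B_k(\mathbf{a})$$ is self-dual, i.e. for every integer $N\ge 0$, $$p_N=\sum_{k=0}^{N}\binom{N}{k}(-1)^k p_k .$$
   Context: For $\mathbf{a}=(a_1,\dots,a_n)$ with nonzero complex entries, the Bernoulli-Barnes numbers $B_k(\mathbf{a})$, $k\ge 0$, are defined by the exponential generating function $$\prod_{j=1}^{n}\frac{z}{e^{a_j z}-1}=\sum_{k=0}^{\infty}\frac{B_k(\mathbf{a})}{k!}z^k$$ (as a power series at $z=0$). A sequence $(u_k)_{k\ge0}$ is called self-dual if $u_N=\sum_{k=0}^{N}\binom{N}{k}(-1)^k u_k$ for all integers $N\ge 0$. *)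

theory Defs
  imports Complex_Main "HOL-Computational_Algebra.Formal_Power_Series"
begin

text \<open>
  The \<open>n\<close>-tuple \<open>a\<^sub>1, \<dots>, a\<^sub>n\<close> is given by the values of \<open>a :: nat \<Rightarrow> complex\<close> on \<open>{1..n}\<close>;
  other values of \<open>a\<close> are irrelevant. For \<open>a j \<noteq> 0\<close> the series \<open>fps_exp (a j) - 1\<close> has
  subdegree 1, so the division of formal power series below is exact.
\<close>

definition bernoulli_barnes_gf :: "nat \<Rightarrow> (nat \<Rightarrow> complex) \<Rightarrow> complex fps" where
  "bernoulli_barnes_gf n a = (\<Prod>j = 1..n. fps_X / (fps_exp (a j) - 1))"

definition bernoulli_barnes :: "nat \<Rightarrow> (nat \<Rightarrow> complex) \<Rightarrow> nat \<Rightarrow> complex" where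
  "bernoulli_barnes n a k = fact k * fps_nth (bernoulli_barnes_gf n a) k"

definition self_dual :: "(nat \<Rightarrow> complex) \<Rightarrow> bool" where
  "self_dual u \<longleftrightarrow> (\<forall>N. u N = (\<Sum>k = 0..N. of_nat (N choose k) * (-1) ^ k * u k))"

end

theory Submission
  imports Defs
begin

text \<open>
  The generating function \<open>G(z)\<close> of the Bernoulli-Barnes numbers satisfies the reflection
  \<open>G(-z) = e\<^bsup>Az\<^esup> G(z)\<close>: each factor \<open>z / (e\<^bsup>cz\<^esup> - 1)\<close> picks up \<open>e\<^bsup>cz\<^esup>\<close> under \<open>z \<mapsto> -z\<close>
  (\<open>fps_bernoulli_factor_reflect\<close>), and these exponentials multiply to \<open>e\<^bsup>Az\<^esup>\<close>
  (\<open>bernoulli_barnes_gf_reflect\<close>).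

  Self-duality of \<open>u\<close> says that its exponential generating function \<open>U\<close> satisfies
  \<open>U(z) = e\<^sup>z U(-z)\<close>. Here \<open>U(z) = G(-z/A)\<close>, so this is exactly the reflection of \<open>G\<close> with
  \<open>z\<close> rescaled by \<open>A\<close>; \<open>self_dual_if_egf_reflect\<close> reads it off from the coefficients.
\<close>

text \<open>
  Replacing \<open>z\<close> by \<open>-z\<close> gives \<open>-z / (e\<^bsup>-cz\<^esup> - 1)\<close>; expand the fraction by \<open>e\<^bsup>cz\<^esup>\<close>.
\<close>

lemma fps_bernoulli_factor_reflect:
  fixes c :: "'a::field_char_0"
  assumes "c \<noteq> 0"
  shows "(fps_X / (fps_exp c - 1)) oo (- fps_X) = fps_exp c * (fps_X / (fps_exp c - 1))"
proof -
  define E where "E = fps_exp c"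
  define g where "g = fps_X / (E - 1)"
  have nz: "E - 1 \<noteq> 0"
    using assms by (simp add: E_def)
  have "subdegree (E - 1) \<le> 1"
    using assms by (intro subdegree_leI) (simp add: E_def)
  then have "(E - 1) dvd fps_X"
    using nz by (simp add: fps_dvd_iff)
  then have g: "g * (E - 1) = fps_X"
    by (simp add: g_def)
  have E': "E * fps_exp (- c) = 1"
    by (simp add: E_def flip: fps_exp_add_mult)
  have "(g oo - fps_X) * ((E - 1) oo - fps_X) = fps_X oo - fps_X"
    using arg_cong[OF g, of "\<lambda>f. f oo - fps_X"] by (simp add: fps_compose_mult_distrib)
  then have "(g oo - fps_X) * (fps_exp (- c) - 1) = - fps_X"
    by (simp add: E_def fps_compose_sub_distrib)
  then have "E * ((g oo - fps_X) * (fps_exp (- c) - 1)) = - (E * fps_X)"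
    by simp
  then have "(g oo - fps_X) * (E * fps_exp (- c) - E) = - (E * fps_X)"
    by (simp add: algebra_simps)
  then have "(g oo - fps_X) * (E - 1) = E * fps_X"
    by (simp add: E' algebra_simps)
  then have "(g oo - fps_X) * (E - 1) = (E * g) * (E - 1)"
    by (simp only: mult.assoc g)
  then show ?thesis
    using nz by (simp add: g_def E_def)
qed

lemma fps_exp_sum:
  fixes f :: "'b \<Rightarrow> 'a::field_char_0"
  shows "fps_exp (\<Sum>x\<in>S. f x) = (\<Prod>x\<in>S. fps_exp (f x))"
  by (induction S rule: infinite_finite_induct) (simp_all add: fps_exp_add_mult)

lemma bernoulli_barnes_gf_reflect:
  assumes "\<And>j. j \<in> {1..n} \<Longrightarrow> a j \<noteq> 0"
  shows "bernoulli_barnes_gf n a oo (- fps_X) = fps_exp (\<Sum>j = 1..n. a j) * bernoulli_barnes_gf n a"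
proof -
  have "bernoulli_barnes_gf n a oo (- fps_X)
      = (\<Prod>j = 1..n. (fps_X / (fps_exp (a j) - 1)) oo (- fps_X))"
    by (simp add: bernoulli_barnes_gf_def fps_compose_prod_distrib)
  also have "\<dots> = (\<Prod>j = 1..n. fps_exp (a j) * (fps_X / (fps_exp (a j) - 1)))"
    by (intro prod.cong refl fps_bernoulli_factor_reflect assms)
  finally show ?thesis
    by (simp add: bernoulli_barnes_gf_def fps_exp_sum prod.distrib)
qed

text \<open>
  Compare the coefficients of \<open>z\<^sup>N\<close> on both sides and multiply by \<open>N! / A\<^sup>N\<close>. On the right
  the weight of \<open>G\<^sub>k\<close> becomes \<open>(N choose k) k! / A\<^sup>k\<close>.
\<close>

lemma self_dual_if_egf_reflect:
  fixes G :: "complex fps"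
  assumes reflect: "G oo (- fps_X) = fps_exp A * G" and "A \<noteq> 0"
  shows "self_dual (\<lambda>k. (-1) ^ k * A powi (- int k) * (fact k * fps_nth G k))"
  unfolding self_dual_def
proof
  fix N
  have "(-1) ^ N * fps_nth G N = fps_nth (G oo (- fps_X)) N"
    using fps_compose_linear[of G "-1"] by (simp flip: fps_const_neg)
  also have "\<dots> = (\<Sum>k = 0..N. fps_nth G k * (A ^ (N - k) / fact (N - k)))"
    unfolding reflect by (subst mult.commute) (simp add: fps_mult_nth)
  finally have coeff: "(-1) ^ N * fps_nth G N
      = (\<Sum>k = 0..N. fps_nth G k * (A ^ (N - k) / fact (N - k)))" .
  have "(-1) ^ N * A powi (- int N) * (fact N * fps_nth G N)
      = fact N / A ^ N * ((-1) ^ N * fps_nth G N)"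
    by (simp add: power_int_minus divide_inverse)
  also have "\<dots> = (\<Sum>k = 0..N. fact N / A ^ N * (fps_nth G k * (A ^ (N - k) / fact (N - k))))"
    by (simp only: coeff sum_distrib_left)
  also have "\<dots> = (\<Sum>k = 0..N. of_nat (N choose k) * (-1) ^ k *
      ((-1) ^ k * A powi (- int k) * (fact k * fps_nth G k)))"
  proof (rule sum.cong[OF refl])
    fix k assume "k \<in> {0..N}"
    then have k: "k \<le> N" by simp
    have "A ^ N = A ^ k * A ^ (N - k)"
      using k by (simp flip: power_add)
    moreover have "(-1) ^ k * (-1) ^ k = (1::complex)"
      by (simp flip: power_mult_distrib)
    ultimately show "fact N / A ^ N * (fps_nth G k * (A ^ (N - k) / fact (N - k)))
      = of_nat (N choose k) * (-1) ^ k * ((-1) ^ k * A powi (- int k) * (fact k * fps_nth G k))"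
      using \<open>A \<noteq> 0\<close> by (simp add: binomial_fact[OF k] power_int_minus field_simps)
  qed
  finally show "(-1) ^ N * A powi (- int N) * (fact N * fps_nth G N)
      = (\<Sum>k = 0..N. of_nat (N choose k) * (-1) ^ k *
          ((-1) ^ k * A powi (- int k) * (fact k * fps_nth G k)))" .
qed

theorem theorem5p1:
  fixes n :: nat and a :: "nat \<Rightarrow> complex" and A :: complex
  assumes "n \<ge> 1"
    and "\<And>j. j \<in> {1..n} \<Longrightarrow> a j \<noteq> 0"
    and "A = (\<Sum>j = 1..n. a j)"
    and "A \<noteq> 0"
  shows "self_dual (\<lambda>k. (-1) ^ k * A powi (- int k) * bernoulli_barnes n a k)"
  unfolding bernoulli_barnes_def
proof (rule self_dual_if_egf_reflect)
  show "bernoulli_barnes_gf n a oo (- fps_X) = fps_exp A * bernoulli_barnes_gf n a"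
    unfolding assms(3) using assms(2) by (rule bernoulli_barnes_gf_reflect)
qed fact

end
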